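(* Let $d\ge2$, let $X_1,\ldots,X_d$ and $Y$ be sequence classes with $Y$ linearly stable and let $E_1,\ldots,E_d,F$ be Banach spaces. If $\mathcal{L}(E_1,\ldots,E_d;F)=\mathcal{L}^{\mathbb{N}^d}_{X_1,\ldots,X_d;{}^dY}(E_1,\ldots,E_d;F)$, then $\mathcal{L}(E_2,\ldots,E_d;F)=\mathcal{L}^{\mathbb{N}^{d-1}}_{X_2,\ldots,X_d;{}^{d-1}Y}(E_2,\ldots,E_d;F)$.
   Context: All Banach spaces are over $\mathbb{K}=\mathbb{R}$ or $\mathbb{C}$; $\mathcal{L}(E_1,\ldots,E_d;F)$ is the Banach space of continuous $d$-linear operators from $E_1\times\cdots\times E_d$ to $F$ with the usual operator norm. A sequence class is a rule $X$ assigning to each Banach space $E$ a Banach space $X(E)$ of $E$-valued sequences (coordinatewise operations) such that $c_{00}(E)\subset X(E)\subset\ell_\infty(E)$ with $\|x\|_{\ell_\infty(E)}\le\|x\|_{X(E)}$ for $x\in X(E)$, and $\|e_j\|_{X(\mathbb{K})}=1$ for every $j$ ($c_{00}(E)$: eventually null sequences; $\ell_\infty(E)$: bounded sequences with the sup norm; $e_j$: canonical scalar unit sequences). $X$ is linearly stable if for all Banach spaces $E,F$, $u\in\mathcal{L}(E;F)$ and $(x_j)_j\in X(E)$ one has $(u(x_j))_j\in X(F)$ and $\|(u(x_j))_j\|_{X(F)}\le\|u\|\,\|(x_j)_j\|_{X(E)}$. For $t\ge1$, Banach spaces $G_1,\ldots,G_t,F$ and sequence classes $Z_1,\ldots,Z_t,Y$,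 $\mathcal{L}^{\mathbb{N}^t}_{Z_1,\ldots,Z_t;{}^tY}(G_1,\ldots,G_t;F)$ is the set of $A\in\mathcal{L}(G_1,\ldots,G_t;F)$ such that the iterated sequence $\left(\cdots\left(A(x^1_{n_1},\ldots,x^t_{n_t})\right)_{n_t=1}^\infty\cdots\right)_{n_1=1}^\infty$ belongs to $Y(\stackrel{t}{\cdots}Y(F)\cdots)$ ($Y$ applied $t$ times) whenever $(x_j^r)_j\in Z_r(G_r)$, $r=1,\ldots,t$.
   Formalization: The space E_1 is assumed to be nonzero; for E_1 = {0} the claim fails, e.g. d = 2, X_2 = ℓ_∞(·), Y = ℓ_1(·), E_2 = F = K, where the premise holds trivially but the identity is not summing. *)

theory Defs
  imports "HOL-Analysis.Analysis" "HOL-Algebra.Module"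
begin

section \<open>Banach spaces as objects\<close>

text \<open>
  A sequence class \<open>Y\<close> acts on all Banach spaces and is applied repeatedly (\<open>Y(Y(F))\<close>), so Banach
  spaces have to be objects whose carriers live in one type that is closed under forming sequences
  and that contains the scalars. The type \<open>'a univ\<close> below is the least such type over an arbitrary
  type \<open>'a\<close> of points; as \<open>'a\<close> is arbitrary, spaces of every size occur.
\<close>

datatype 'a univ =
    Scalar (scalar_val: complex)
  | Point 'a
  | Seq (nth_term: "nat \<Rightarrow> 'a univ")

text \<open>The fields \<open>mult\<close> and \<open>one\<close> that a \<open>module\<close> record inherits play no role for the spaces.\<close>

record 'b nspace = "(complex, 'b) module" +
  nrm :: "'b \<Rightarrow> real"

definition scalar_field :: "complex set \<Rightarrow> complex ring" where
  "scalar_field K = \<lparr>carrier = K, mult = (*), one = 1, zero = 0, add = (+)\<rparr>"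

text \<open>
  The value \<open>0\<close> off the carrier only serves to meet the requirements of \<open>Metric_space\<close>, some of
  which range over the whole type.
\<close>

definition ndist :: "'b nspace \<Rightarrow> 'b \<Rightarrow> 'b \<Rightarrow> real" where
  "ndist E x y = (if x \<in> carrier E \<and> y \<in> carrier E then nrm E (x \<ominus>\<^bsub>E\<^esub> y) else 0)"

abbreviation ntop :: "'b nspace \<Rightarrow> 'b topology" where
  "ntop E \<equiv> Metric_space.mtopology (carrier E) (ndist E)"

text \<open>In what follows \<open>K\<close> is the scalar field, that is \<open>K = \<real>\<close> or \<open>K = UNIV\<close>.\<close>

definition banach_space :: "complex set \<Rightarrow> 'b nspace \<Rightarrow> bool" where
  "banach_space K E \<longleftrightarrow>
     Module.module (scalar_field K) E \<and>
     (\<forall>x\<in>carrier E. nrm E x = 0 \<longleftrightarrow> x = \<zero>\<^bsub>E\<^esub>) \<and>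
     (\<forall>x\<in>carrier E. \<forall>y\<in>carrier E. nrm E (x \<oplus>\<^bsub>E\<^esub> y) \<le> nrm E x + nrm E y) \<and>
     (\<forall>c\<in>K. \<forall>x\<in>carrier E. nrm E (c \<odot>\<^bsub>E\<^esub> x) = cmod c * nrm E x) \<and>
     Metric_space.mcomplete (carrier E) (ndist E)"

definition scalar_space :: "complex set \<Rightarrow> 'a univ nspace" where
  "scalar_space K =
     \<lparr>carrier = Scalar ` K,
      mult = (\<lambda>x y. Scalar (scalar_val x * scalar_val y)), one = Scalar 1,
      zero = Scalar 0, add = (\<lambda>x y. Scalar (scalar_val x + scalar_val y)),
      smult = (\<lambda>c x. Scalar (c * scalar_val x)),
      nrm = (\<lambda>x. cmod (scalar_val x))\<rparr>"


section \<open>Linear and multilinear operators\<close>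

definition linear_map :: "complex set \<Rightarrow> 'b nspace \<Rightarrow> 'c nspace \<Rightarrow> ('b \<Rightarrow> 'c) \<Rightarrow> bool" where
  "linear_map K E F u \<longleftrightarrow>
     u \<in> carrier E \<rightarrow> carrier F \<and>
     (\<forall>x\<in>carrier E. \<forall>y\<in>carrier E. u (x \<oplus>\<^bsub>E\<^esub> y) = u x \<oplus>\<^bsub>F\<^esub> u y) \<and>
     (\<forall>c\<in>K. \<forall>x\<in>carrier E. u (c \<odot>\<^bsub>E\<^esub> x) = c \<odot>\<^bsub>F\<^esub> u x)"

definition lin_ops :: "complex set \<Rightarrow> 'b nspace \<Rightarrow> 'c nspace \<Rightarrow> ('b \<Rightarrow> 'c) set" where
  "lin_ops K E F =
     {u \<in> extensional (carrier E). linear_map K E F u \<and> continuous_map (ntop E) (ntop F) u}"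

definition op_norm :: "'b nspace \<Rightarrow> 'c nspace \<Rightarrow> ('b \<Rightarrow> 'c) \<Rightarrow> real" where
  "op_norm E F u = (SUP x\<in>{x \<in> carrier E. nrm E x \<le> 1}. nrm F (u x))"

text \<open>
  Finite families are indexed by \<open>{..<t}\<close>: \<open>G i\<close> stands for the space \<open>G\<^sub>i\<^sub>+\<^sub>1\<close>. Points of
  \<open>G\<^sub>1 \<times> \<dots> \<times> G\<^sub>t\<close> are the elements of the extensional product, and operators are
  extensional on it so that equality of operators is equality of functions.
\<close>

definition multilin_ops ::
  "complex set \<Rightarrow> nat \<Rightarrow> (nat \<Rightarrow> 'b nspace) \<Rightarrow> 'c nspace \<Rightarrow> ((nat \<Rightarrow> 'b) \<Rightarrow> 'c) set" where
  "multilin_ops K t G F =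
     {A \<in> extensional (\<Pi>\<^sub>E i\<in>{..<t}. carrier (G i)).
        (\<forall>x \<in> (\<Pi>\<^sub>E i\<in>{..<t}. carrier (G i)). \<forall>i<t.
           linear_map K (G i) F (\<lambda>v. A (x(i := v)))) \<and>
        continuous_map (product_topology (\<lambda>i. ntop (G i)) {..<t}) (ntop F) A}"


section \<open>Sequence classes\<close>

definition seqs_in :: "'b nspace \<Rightarrow> (nat \<Rightarrow> 'b) set" where
  "seqs_in E = {x. \<forall>j. x j \<in> carrier E}"

definition c00 :: "'b nspace \<Rightarrow> (nat \<Rightarrow> 'b) set" where
  "c00 E = {x \<in> seqs_in E. \<forall>\<^sub>F j in sequentially. x j = \<zero>\<^bsub>E\<^esub>}"

definition linf :: "'b nspace \<Rightarrow> (nat \<Rightarrow> 'b) set" where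
  "linf E = {x \<in> seqs_in E. bdd_above (range (\<lambda>j. nrm E (x j)))}"

definition linf_norm :: "'b nspace \<Rightarrow> (nat \<Rightarrow> 'b) \<Rightarrow> real" where
  "linf_norm E x = (SUP j. nrm E (x j))"

type_synonym 'a seq_rule = "'a univ nspace \<Rightarrow> 'a univ nspace"

definition seq_class :: "complex set \<Rightarrow> 'a seq_rule \<Rightarrow> bool" where
  "seq_class K X \<longleftrightarrow>
     (\<forall>E. banach_space K E \<longrightarrow>
        banach_space K (X E) \<and>
        Seq ` c00 E \<subseteq> carrier (X E) \<and> carrier (X E) \<subseteq> Seq ` linf E \<and>
        \<zero>\<^bsub>X E\<^esub> = Seq (\<lambda>j. \<zero>\<^bsub>E\<^esub>) \<and>
        (\<forall>x y. Seq x \<in> carrier (X E) \<and> Seq y \<in> carrier (X E) \<longrightarrow>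
           Seq x \<oplus>\<^bsub>X E\<^esub> Seq y = Seq (\<lambda>j. x j \<oplus>\<^bsub>E\<^esub> y j)) \<and>
        (\<forall>c\<in>K. \<forall>x. Seq x \<in> carrier (X E) \<longrightarrow>
           c \<odot>\<^bsub>X E\<^esub> Seq x = Seq (\<lambda>j. c \<odot>\<^bsub>E\<^esub> x j)) \<and>
        (\<forall>x. Seq x \<in> carrier (X E) \<longrightarrow> linf_norm E x \<le> nrm (X E) (Seq x))) \<and>
     (\<forall>j. nrm (X (scalar_space K)) (Seq (\<lambda>i. Scalar (if i = j then 1 else 0))) = 1)"

definition linearly_stable :: "complex set \<Rightarrow> 'a seq_rule \<Rightarrow> bool" where
  "linearly_stable K X \<longleftrightarrow>
     (\<forall>E F. banach_space K E \<and> banach_space K F \<longrightarrow>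
        (\<forall>u\<in>lin_ops K E F. \<forall>x. Seq x \<in> carrier (X E) \<longrightarrow>
           Seq (\<lambda>j. u (x j)) \<in> carrier (X F) \<and>
           nrm (X F) (Seq (\<lambda>j. u (x j))) \<le> op_norm E F u * nrm (X E) (Seq x)))"

text \<open>
  \<open>iter_seq t a\<close> is the iterated sequence of the array \<open>a\<close>, whose index \<open>[n\<^sub>1, \<dots>, n\<^sub>t]\<close>
  is a list; \<open>n\<^sub>1\<close> runs in the outermost sequence.
\<close>

fun iter_seq :: "nat \<Rightarrow> (nat list \<Rightarrow> 'a univ) \<Rightarrow> 'a univ" where
  "iter_seq 0 a = a []"
| "iter_seq (Suc t) a = Seq (\<lambda>n. iter_seq t (\<lambda>ns. a (n # ns)))"

definition summing_ops ::
  "complex set \<Rightarrow> nat \<Rightarrow> (nat \<Rightarrow> 'a seq_rule) \<Rightarrow> 'a seq_rule \<Rightarrow> (nat \<Rightarrow> 'a univ nspace) \<Rightarrow>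
     'a univ nspace \<Rightarrow> ((nat \<Rightarrow> 'a univ) \<Rightarrow> 'a univ) set" where
  "summing_ops K t Z Y G F =
     {A \<in> multilin_ops K t G F.
        \<forall>x. (\<forall>r<t. Seq (x r) \<in> carrier (Z r (G r))) \<longrightarrow>
          iter_seq t (\<lambda>ns. A (\<lambda>r\<in>{..<t}. x r (ns ! r))) \<in> carrier ((Y ^^ t) F)}"

end

theory Submission
  imports Defs
begin

text \<open>
  Fix \<open>a \<noteq> 0\<close> in \<open>E\<^sub>1\<close> and, by Hahn-Banach, a continuous functional \<open>\<phi>\<close> with \<open>\<phi>(a) = 1\<close>. For a
  continuous \<open>(d-1)\<close>-linear \<open>B\<close> apply the hypothesis to the operator \<open>\<phi>(x\<^sub>1) B(x\<^sub>2, \<dots>, x\<^sub>d)\<close> and to the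
  sequence \<open>(a, 0, 0, \<dots>)\<close> in the first variable: the first term of the resulting element of
  \<open>Y(\<dots>Y(F)\<dots>)\<close> (\<open>d\<close> times) is the iterated sequence of \<open>B\<close>, which therefore lies in \<open>Y(\<dots>Y(F)\<dots>)\<close>
  (\<open>d-1\<close> times). The Hahn-Banach functional is a minimal sublinear functional, in the pointwise
  order, below one that is at most \<open>- \<parallel>a\<parallel>\<close> at \<open>- a\<close>; minimality forces linearity.
\<close>

section \<open>Vector space algebra in a Banach space over \<open>K\<close>\<close>

locale banach =
  fixes K :: "complex set" and E :: "'b nspace" (structure)
  assumes scalars: "K = \<real> \<or> K = UNIV" and banach: "banach_space K E"

sublocale banach \<subseteq> module "scalar_field K" E
  using banach by (simp add: banach_space_def)

context banach
begin

lemma of_real_scalar [simp, intro]: "complex_of_real t \<in> K"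
  using scalars by auto

lemma one_scalar [simp, intro]: "1 \<in> K" and zero_scalar [simp, intro]: "0 \<in> K"
  using of_real_scalar[of 1] of_real_scalar[of 0] by simp_all

lemma diff_scalar [intro]: "c \<in> K \<Longrightarrow> e \<in> K \<Longrightarrow> c - e \<in> K"
  and divide_scalar [intro]: "c \<in> K \<Longrightarrow> e \<in> K \<Longrightarrow> c / e \<in> K"
  using scalars by auto

lemma scale_closed [simp, intro]: "c \<in> K \<Longrightarrow> x \<in> carrier E \<Longrightarrow> c \<odot> x \<in> carrier E"
  using smult_closed[of c x] by (simp add: scalar_field_def)

lemma scale_add_left: "c \<in> K \<Longrightarrow> e \<in> K \<Longrightarrow> x \<in> carrier E \<Longrightarrow> (c + e) \<odot> x = c \<odot> x \<oplus> e \<odot> x"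
  using smult_l_distr[of c e x] by (simp add: scalar_field_def)

lemma scale_add_right:
  "c \<in> K \<Longrightarrow> x \<in> carrier E \<Longrightarrow> y \<in> carrier E \<Longrightarrow> c \<odot> (x \<oplus> y) = c \<odot> x \<oplus> c \<odot> y"
  using smult_r_distr[of c x y] by (simp add: scalar_field_def)

lemma scale_scale: "c \<in> K \<Longrightarrow> e \<in> K \<Longrightarrow> x \<in> carrier E \<Longrightarrow> c \<odot> (e \<odot> x) = (c * e) \<odot> x"
  using smult_assoc1[of c e x] by (simp add: scalar_field_def)

lemma scale_one [simp]: "x \<in> carrier E \<Longrightarrow> 1 \<odot> x = x"
  using smult_one[of x] by (simp add: scalar_field_def)

lemma scale_zero_left [simp]: "x \<in> carrier E \<Longrightarrow> 0 \<odot> x = \<zero>"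
  using smult_l_null[of x] by (simp add: scalar_field_def)

lemma scale_zero_right [simp]: "c \<in> K \<Longrightarrow> c \<odot> \<zero> = \<zero>"
  using smult_r_null[of c] by (simp add: scalar_field_def)

lemma scale_minus_one: "x \<in> carrier E \<Longrightarrow> (- 1) \<odot> x = \<ominus> x"
proof -
  assume x: "x \<in> carrier E"
  have m: "- 1 \<in> K" using of_real_scalar[of "- 1"] by simp
  have "(- 1) \<odot> x \<oplus> x = \<zero>"
    using scale_add_left[of "- 1" 1 x] x m by simp
  then show ?thesis using x m by (metis minus_equality scale_closed)
qed

section \<open>The norm and its metric\<close>

lemma nrm_eq_0: "x \<in> carrier E \<Longrightarrow> nrm E x = 0 \<longleftrightarrow> x = \<zero>"
  and nrm_add: "x \<in> carrier E \<Longrightarrow> y \<in> carrier E \<Longrightarrow> nrm E (x \<oplus> y) \<le> nrm E x + nrm E y"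
  and nrm_scale: "c \<in> K \<Longrightarrow> x \<in> carrier E \<Longrightarrow> nrm E (c \<odot> x) = cmod c * nrm E x"
  using banach by (auto simp: banach_space_def)

lemma nrm_zero [simp]: "nrm E \<zero> = 0"
  using nrm_eq_0 by simp

lemma nrm_minus [simp]: "x \<in> carrier E \<Longrightarrow> nrm E (\<ominus> x) = nrm E x"
  using nrm_scale[of "- 1" x] of_real_scalar[of "- 1"] by (simp add: scale_minus_one)

lemma nrm_nonneg [simp]: "x \<in> carrier E \<Longrightarrow> 0 \<le> nrm E x"
  using nrm_add[of x "\<ominus> x"] by (simp add: r_neg)

lemma minus_zero_vector [simp]: "\<ominus> \<zero> = \<zero>"
  using minus_equality[of \<zero> \<zero>] by simp

lemma diff_add_cancel_vector: "x \<in> carrier E \<Longrightarrow> y \<in> carrier E \<Longrightarrow> (x \<ominus> y) \<oplus> y = x"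
  by (simp add: minus_eq a_assoc l_neg)

lemma diff_eq_zero_iff: "x \<in> carrier E \<Longrightarrow> y \<in> carrier E \<Longrightarrow> x \<ominus> y = \<zero> \<longleftrightarrow> x = y"
  using diff_add_cancel_vector[of x y] by (auto simp: minus_eq r_neg)

lemma diff_add_diff:
  assumes "x \<in> carrier E" "y \<in> carrier E" "z \<in> carrier E"
  shows "(x \<ominus> y) \<oplus> (y \<ominus> z) = x \<ominus> z"
proof -
  have "(x \<ominus> y) \<oplus> (y \<ominus> z) = x \<oplus> ((\<ominus> y \<oplus> y) \<oplus> \<ominus> z)"
    using assms by (simp add: minus_eq a_assoc)
  then show ?thesis using assms by (simp add: l_neg minus_eq)
qed

sublocale metric: Metric_space "carrier E" "ndist E"
proof
  show "0 \<le> ndist E x y" for x y by (simp add: ndist_def)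
  have "nrm E (x \<ominus> y) = nrm E (y \<ominus> x)" if "x \<in> carrier E" "y \<in> carrier E" for x y
  proof -
    have "\<ominus> (x \<ominus> y) = y \<ominus> x"
      using that by (simp add: minus_eq minus_add a_comm)
    then show ?thesis using that nrm_minus[of "x \<ominus> y"] by simp
  qed
  then show "ndist E x y = ndist E y x" for x y by (simp add: ndist_def)
  show "ndist E x y = 0 \<longleftrightarrow> x = y" if "x \<in> carrier E" "y \<in> carrier E" for x y
    using that nrm_eq_0[of "x \<ominus> y"] by (simp add: ndist_def diff_eq_zero_iff)
  show "ndist E x z \<le> ndist E x y + ndist E y z"
    if "x \<in> carrier E" "y \<in> carrier E" "z \<in> carrier E" for x y z
    using that nrm_add[of "x \<ominus> y" "y \<ominus> z"] by (simp add: ndist_def diff_add_diff)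
qed

text \<open>The usual product estimate, with the difference split as
  \<open>g x (h x - h y) + (g x - g y) h y\<close>. It provides the continuity of the product of a
  functional and an operator.\<close>

lemma continuous_map_scale:
  assumes g: "continuous_map T euclidean g" "\<And>x. x \<in> topspace T \<Longrightarrow> g x \<in> K"
    and h: "continuous_map T (ntop E) h"
  shows "continuous_map T (ntop E) (\<lambda>x. g x \<odot> h x)"
  unfolding metric.continuous_map_to_metric
proof (intro ballI allI impI)
  fix x and e :: real
  assume x: "x \<in> topspace T" and e: "0 < e"
  have hE: "h y \<in> carrier E" if "y \<in> topspace T" for y
    using h that by (auto simp: continuous_map_def)
  \<comment> \<open>On the neighbourhood \<open>U\<close> chosen below, \<open>h y\<close> is within
    \<open>\<delta> \<le> 1\<close> of \<open>h x\<close>, so \<open>N\<close> bounds the norm of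
    \<open>h y\<close>. The summand 1 in \<open>N\<close> and \<open>M\<close> also keeps the
    denominators positive.\<close>
  define N where "N = nrm E (h x) + 1"
  have N: "0 < N" using nrm_nonneg[OF hE[OF x]] unfolding N_def by linarith
  define M where "M = cmod (g x) + 1"
  have M: "0 < M" by (simp add: M_def add_nonneg_pos)
  define \<delta> where "\<delta> = min 1 (e / (2 * M))"
  have \<delta>: "0 < \<delta>" using e M by (simp add: \<delta>_def)
  obtain U where U: "openin T U" "x \<in> U" "\<And>y. y \<in> U \<Longrightarrow> h y \<in> metric.mball (h x) \<delta>"
    using h[unfolded metric.continuous_map_to_metric, rule_format, OF x \<delta>] by blast
  define V where "V = {y \<in> topspace T. g y \<in> ball (g x) (e / (2 * N))}"
  have V: "openin T V"
    unfolding V_def by (rule openin_continuous_map_preimage[OF g(1)]) simp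
  show "\<exists>U. openin T U \<and> x \<in> U \<and> (\<forall>y\<in>U. g y \<odot> h y \<in> metric.mball (g x \<odot> h x) e)"
  proof (intro exI conjI ballI)
    show "openin T (U \<inter> V)" using U V by blast
    show "x \<in> U \<inter> V" using U x e N by (simp add: V_def)
    fix y assume y: "y \<in> U \<inter> V"
    then have yT: "y \<in> topspace T" and gy: "cmod (g x - g y) < e / (2 * N)"
      by (auto simp: V_def dist_norm)
    note mem = hE[OF x] hE[OF yT] g(2)[OF x] g(2)[OF yT]
    have hd: "nrm E (h x \<ominus> h y) < \<delta>"
      using U(3)[of y] y mem by (simp add: ndist_def)
    \<comment> \<open>The metric triangle inequality through \<open>h x\<close>, ending at
      \<open>\<zero>\<close>, because the distance to \<open>\<zero>\<close> is the norm.\<close>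
    have "nrm E (h y) \<le> nrm E (h x \<ominus> h y) + nrm E (h x)"
      using metric.triangle''[of "h y" "h x" \<zero>] mem by (simp add: ndist_def minus_eq)
    then have hy: "nrm E (h y) < N" using hd by (simp add: N_def \<delta>_def)
    have dif: "g x \<odot> h x \<ominus> g y \<odot> h y = g x \<odot> (h x \<ominus> h y) \<oplus> (g x - g y) \<odot> h y"
    proof -
      have neg: "g x \<odot> (\<ominus> h y) = \<ominus> (g x \<odot> h y)"
        using smult_r_minus[of "g x" "h y"] mem by (simp add: scalar_field_def)
      have m: "- g y \<in> K" using diff_scalar[of 0 "g y"] mem by simp
      have "\<ominus> (g y \<odot> h y) = (- g y) \<odot> h y"
        using mem m scale_minus_one[of "g y \<odot> h y"] of_real_scalar[of "- 1"]
        by (simp add: scale_scale)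
      moreover have "(g x - g y) \<odot> h y = g x \<odot> h y \<oplus> (- g y) \<odot> h y"
        using scale_add_left[of "g x" "- g y" "h y"] mem m by simp
      ultimately have "(g x - g y) \<odot> h y = g x \<odot> h y \<ominus> g y \<odot> h y"
        by (simp add: minus_eq)
      moreover have "g x \<odot> (h x \<ominus> h y) = g x \<odot> h x \<ominus> g x \<odot> h y"
        using mem by (simp add: minus_eq scale_add_right neg)
      ultimately show ?thesis using mem by (simp add: diff_add_diff)
    qed
    have "nrm E (g x \<odot> h x \<ominus> g y \<odot> h y)
      \<le> cmod (g x) * nrm E (h x \<ominus> h y) + cmod (g x - g y) * nrm E (h y)"
      unfolding dif using nrm_add[of "g x \<odot> (h x \<ominus> h y)" "(g x - g y) \<odot> h y"] mem
      by (simp add: nrm_scale diff_scalar)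
    also have "\<dots> < e / 2 + e / 2"
    proof (rule add_le_less_mono)
      have "cmod (g x) * nrm E (h x \<ominus> h y) \<le> M * (e / (2 * M))"
        using hd mem M by (intro mult_mono) (auto simp: M_def \<delta>_def)
      then show "cmod (g x) * nrm E (h x \<ominus> h y) \<le> e / 2" using M by simp
      have "cmod (g x - g y) * nrm E (h y) \<le> cmod (g x - g y) * N"
        using hy by (intro mult_left_mono) auto
      also have "\<dots> < e / (2 * N) * N" by (rule mult_strict_right_mono[OF gy N])
      finally show "cmod (g x - g y) * nrm E (h y) < e / 2" using N by simp
    qed
    finally show "g y \<odot> h y \<in> metric.mball (g x \<odot> h x) e"
      using mem by (simp add: ndist_def)
  qed
qed

section \<open>The Hahn-Banach theorem\<close>

text \<open>Homogeneity is asked for only as an inequality with positive real factors: this is easy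
  to check for infima and already implies equality. The value 0 off the carrier makes the pointwise
  order depend only on the values on the carrier, so that minimality can be stated as equality of
  functions.\<close>

definition sublinear :: "('b \<Rightarrow> real) \<Rightarrow> bool" where
  "sublinear q \<longleftrightarrow>
     (\<forall>x\<in>carrier E. \<forall>y\<in>carrier E. q (x \<oplus> y) \<le> q x + q y) \<and>
     (\<forall>c>0. \<forall>x\<in>carrier E. q (complex_of_real c \<odot> x) \<le> c * q x) \<and>
     (\<forall>x. x \<notin> carrier E \<longrightarrow> q x = 0)"

lemma sublinear_add:
  "sublinear q \<Longrightarrow> x \<in> carrier E \<Longrightarrow> y \<in> carrier E \<Longrightarrow> q (x \<oplus> y) \<le> q x + q y"
  and sublinear_scale_le:
  "sublinear q \<Longrightarrow> 0 < c \<Longrightarrow> x \<in> carrier E \<Longrightarrow> q (complex_of_real c \<odot> x) \<le> c * q x"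
  and sublinear_off: "sublinear q \<Longrightarrow> x \<notin> carrier E \<Longrightarrow> q x = 0"
  by (simp_all add: sublinear_def)

text \<open>Subadditivity at \<open>\<zero>\<close> gives \<open>q \<zero> \<ge> 0\<close>, and
  halving \<open>\<zero>\<close> gives \<open>q \<zero> \<le> 0\<close>.\<close>

lemma sublinear_zero:
  assumes "sublinear q" shows "q \<zero> = 0"
  using sublinear_add[OF assms, of \<zero> \<zero>] sublinear_scale_le[OF assms, of "1/2" \<zero>]
    scale_zero_right[OF of_real_scalar[of "1/2"]] by simp

text \<open>For positive \<open>c\<close> the reverse inequality is the assumed one for the factor
  \<open>1 / c\<close> at the vector \<open>c x\<close>.\<close>

lemma sublinear_scale:
  assumes q: "sublinear q" and c: "0 \<le> c" and x: "x \<in> carrier E"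
  shows "q (complex_of_real c \<odot> x) = c * q x"
proof (cases "c = 0")
  case True
  then show ?thesis using x sublinear_zero[OF q] by simp
next
  case False
  then have c: "0 < c" using c by simp
  have eq: "complex_of_real (1 / c) \<odot> (complex_of_real c \<odot> x) = x"
    using c x scale_scale[of "complex_of_real (1 / c)" "complex_of_real c" x]
    by (simp flip: of_real_mult del: of_real_divide)
  have "q x \<le> 1 / c * q (complex_of_real c \<odot> x)"
    using sublinear_scale_le[OF q, of "1 / c" "complex_of_real c \<odot> x"] c x eq by simp
  then have "c * q x \<le> q (complex_of_real c \<odot> x)"
    using c by (simp add: field_simps)
  then show ?thesis using sublinear_scale_le[OF q c x] by simp
qed

lemma sublinear_minus:
  assumes "sublinear q" "x \<in> carrier E" shows "- q (\<ominus> x) \<le> q x"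
  using sublinear_add[OF assms(1), of x "\<ominus> x"] sublinear_zero[OF assms(1)] assms(2)
  by (simp add: r_neg)

text \<open>Lowers \<open>q\<close> as far as sublinearity and the value at \<open>a\<close> permit. Since \<open>descent q a (\<ominus> a) \<le> - q a\<close>,
  every sublinear function below \<open>descent q a\<close> is at least \<open>q a\<close> at \<open>a\<close>.\<close>

definition descent :: "('b \<Rightarrow> real) \<Rightarrow> 'b \<Rightarrow> 'b \<Rightarrow> real" where
  "descent q a x =
     (if x \<in> carrier E then INF t\<in>{0..}. q (x \<oplus> complex_of_real t \<odot> a) - t * q a else 0)"

section \<open>Sublinearity of the descent\<close>

context
  fixes q a assumes q: "sublinear q" and a: "a \<in> carrier E"
begin

lemma descent_le:
  assumes x: "x \<in> carrier E" and t: "0 \<le> t"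
  shows "descent q a x \<le> q (x \<oplus> complex_of_real t \<odot> a) - t * q a"
proof -
  \<comment> \<open>A real infimum is meaningful only with a lower bound independent of
    \<open>s\<close>. Writing \<open>s a\<close> as \<open>(x + s a) - x\<close> yields one.\<close>
  have "- q (\<ominus> x) \<le> q (x \<oplus> complex_of_real s \<odot> a) - s * q a" if "0 \<le> s" for s
  proof -
    have "(x \<oplus> complex_of_real s \<odot> a) \<oplus> \<ominus> x = complex_of_real s \<odot> a"
      using x a by (simp add: a_comm[of x] a_assoc r_neg)
    then show ?thesis
      using sublinear_add[OF q, of "x \<oplus> complex_of_real s \<odot> a" "\<ominus> x"] x a
        sublinear_scale[OF q that a] by simp
  qed
  then have "bdd_below ((\<lambda>t. q (x \<oplus> complex_of_real t \<odot> a) - t * q a) ` {0..})"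
    by (intro bdd_belowI2[where m = "- q (\<ominus> x)"]) simp
  then show ?thesis
    unfolding descent_def using x t by (auto intro!: cINF_lower)
qed

lemma descent_greatest:
  assumes "x \<in> carrier E" and "\<And>t. 0 \<le> t \<Longrightarrow> m \<le> q (x \<oplus> complex_of_real t \<odot> a) - t * q a"
  shows "m \<le> descent q a x"
  unfolding descent_def using assms by (auto intro!: cINF_greatest)

lemma descent_le_self: "descent q a \<le> q"
proof (rule le_funI)
  fix x
  show "descent q a x \<le> q x"
    using descent_le[of x 0] a sublinear_off[OF q]
    by (cases "x \<in> carrier E") (auto simp: descent_def)
qed

text \<open>The parameters add up: \<open>s\<close> for \<open>x\<close> and \<open>t\<close> for
  \<open>y\<close> serve as \<open>s + t\<close> for \<open>x \<oplus> y\<close>. Under scaling by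
  \<open>c\<close> the parameter \<open>t\<close> becomes \<open>c * t\<close>.\<close>

lemma sublinear_descent: "sublinear (descent q a)"
  unfolding sublinear_def
proof (intro conjI ballI allI impI)
  fix x y assume x: "x \<in> carrier E" and y: "y \<in> carrier E"
  have *: "descent q a (x \<oplus> y) \<le> (q (x \<oplus> complex_of_real s \<odot> a) - s * q a) +
    (q (y \<oplus> complex_of_real t \<odot> a) - t * q a)" if "0 \<le> s" "0 \<le> t" for s t
  proof -
    have "(x \<oplus> y) \<oplus> complex_of_real (s + t) \<odot> a =
      (x \<oplus> complex_of_real s \<odot> a) \<oplus> (y \<oplus> complex_of_real t \<odot> a)"
      using x y a by (simp add: scale_add_left a_ac)
    then show ?thesis
      using descent_le[of "x \<oplus> y" "s + t"] that x y a
        sublinear_add[OF q, of "x \<oplus> complex_of_real s \<odot> a" "y \<oplus> complex_of_real t \<odot> a"]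
      by (simp add: algebra_simps)
  qed
  \<comment> \<open>The two infima are taken one after the other, first over \<open>t\<close> with
    \<open>s\<close> fixed.\<close>
  have "descent q a (x \<oplus> y) - descent q a y \<le> q (x \<oplus> complex_of_real s \<odot> a) - s * q a"
    if "0 \<le> s" for s
    using descent_greatest[OF y, of "descent q a (x \<oplus> y) - (q (x \<oplus> complex_of_real s \<odot> a) - s * q a)"]
      *[OF that] by fastforce
  then show "descent q a (x \<oplus> y) \<le> descent q a x + descent q a y"
    using descent_greatest[OF x, of "descent q a (x \<oplus> y) - descent q a y"] by fastforce
next
  fix c :: real and x assume c: "0 < c" and x: "x \<in> carrier E"
  have "descent q a (complex_of_real c \<odot> x) / c \<le> q (x \<oplus> complex_of_real t \<odot> a) - t * q a"
    if "0 \<le> t" for t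
  proof -
    have eq: "complex_of_real c \<odot> x \<oplus> complex_of_real (c * t) \<odot> a =
      complex_of_real c \<odot> (x \<oplus> complex_of_real t \<odot> a)"
      using x a by (simp add: scale_add_right scale_scale)
    have "descent q a (complex_of_real c \<odot> x)
      \<le> q (complex_of_real c \<odot> x \<oplus> complex_of_real (c * t) \<odot> a) - c * t * q a"
      using descent_le[of "complex_of_real c \<odot> x" "c * t"] c x that by simp
    also have "\<dots> = c * (q (x \<oplus> complex_of_real t \<odot> a) - t * q a)"
      unfolding eq using sublinear_scale[OF q, of c "x \<oplus> complex_of_real t \<odot> a"] c x a
      by (simp add: algebra_simps)
    finally show ?thesis using c by (simp add: field_simps)
  qed
  then have "descent q a (complex_of_real c \<odot> x) / c \<le> descent q a x"
    by (rule descent_greatest[OF x])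
  then show "descent q a (complex_of_real c \<odot> x) \<le> c * descent q a x"
    using c by (simp add: field_simps)
qed (simp add: descent_def)

end

text \<open>Subadditivity of an infimum needs a common lower bound in \<open>C\<close> for any two
  members; in a chain the smaller of the two is one.\<close>

lemma sublinear_INF_chain:
  assumes C: "C \<noteq> {}" "\<And>q. q \<in> C \<Longrightarrow> sublinear q"
    and chain: "\<And>q r. q \<in> C \<Longrightarrow> r \<in> C \<Longrightarrow> q \<le> r \<or> r \<le> q"
    and bdd: "\<And>x. bdd_below ((\<lambda>q. q x) ` C)"
  shows "sublinear (\<lambda>x. INF q\<in>C. q x)"
  unfolding sublinear_def
proof (intro conjI ballI allI impI)
  fix x y assume x: "x \<in> carrier E" and y: "y \<in> carrier E"
  let ?I = "\<lambda>x. INF q\<in>C. q x"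
  have *: "?I (x \<oplus> y) \<le> q x + r y" if qr: "q \<in> C" "r \<in> C" for q r
  proof -
    obtain s where s: "s \<in> C" "s \<le> q" "s \<le> r" using chain[OF qr] qr by blast
    have "?I (x \<oplus> y) \<le> s (x \<oplus> y)" by (rule cINF_lower[OF bdd s(1)])
    also have "\<dots> \<le> s x + s y" by (rule sublinear_add[OF C(2)[OF s(1)] x y])
    also have "\<dots> \<le> q x + r y" using s by (intro add_mono) (auto simp: le_fun_def)
    finally show ?thesis .
  qed
  have "?I (x \<oplus> y) - q x \<le> ?I y" if "q \<in> C" for q
    using *[OF that] by (intro cINF_greatest[OF C(1)]) fastforce
  then have "?I (x \<oplus> y) - ?I y \<le> ?I x"
    by (intro cINF_greatest[OF C(1)]) fastforce
  then show "?I (x \<oplus> y) \<le> ?I x + ?I y" by simp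
next
  fix c :: real and x assume c: "0 < c" and x: "x \<in> carrier E"
  have "(INF q\<in>C. q (complex_of_real c \<odot> x)) / c \<le> (INF q\<in>C. q x)"
  proof (rule cINF_greatest[OF C(1)])
    fix q assume q: "q \<in> C"
    have "(INF q\<in>C. q (complex_of_real c \<odot> x)) \<le> q (complex_of_real c \<odot> x)"
      by (rule cINF_lower[OF bdd q])
    also have "\<dots> \<le> c * q x" by (rule sublinear_scale_le[OF C(2)[OF q] c x])
    finally show "(INF q\<in>C. q (complex_of_real c \<odot> x)) / c \<le> q x"
      using c by (simp add: field_simps)
  qed
  then show "(INF q\<in>C. q (complex_of_real c \<odot> x)) \<le> c * (INF q\<in>C. q x)"
    using c by (simp add: field_simps)
next
  fix x assume "x \<notin> carrier E"
  then have "(\<lambda>q. q x) ` C = {0}"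
    using C sublinear_off by (fastforce simp: image_iff)
  then show "(INF q\<in>C. q x) = 0" by simp
qed

text \<open>Zorn's lemma for the reversed order: pointwise infima bound the nonempty chains.\<close>

lemma minimal_sublinear:
  assumes p: "sublinear p"
  obtains f where "sublinear f" "f \<le> p" "\<And>q. sublinear q \<Longrightarrow> q \<le> f \<Longrightarrow> q = f"
proof -
  define S where "S = {q. sublinear q \<and> q \<le> p}"
  have "\<exists>m\<in>S. \<forall>q\<in>S. m \<ge> q \<longrightarrow> q = m"
  proof (rule predicate_Zorn)
    show "partial_order_on S (relation_of (\<ge>) S)"
      by (auto simp: partial_order_on_def preorder_on_def relation_of_def
          intro!: refl_onI transI antisymI)
    fix C assume "C \<in> Chains (relation_of (\<ge>) S)"
    then have CS: "C \<subseteq> S" and chain: "\<And>q r. q \<in> C \<Longrightarrow> r \<in> C \<Longrightarrow> q \<le> r \<or> r \<le> q"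
      by (auto simp: Chains_def relation_of_def)
    show "\<exists>u\<in>S. \<forall>q\<in>C. q \<ge> u"
    \<comment> \<open>An infimum of reals over the empty set says nothing, so the empty chain is
      bounded by \<open>p\<close> itself.\<close>
    proof (cases "C = {}")
      case True
      then show ?thesis using p by (auto simp: S_def)
    next
      case False
      \<comment> \<open>Values cannot decrease without bound along the chain:
        \<open>q x \<ge> - q (\<ominus> x) \<ge> - p (\<ominus> x)\<close> on the carrier, a bound
        free of \<open>q\<close>.\<close>
      have low: "(if x \<in> carrier E then - p (\<ominus> x) else 0) \<le> q x" if "q \<in> C" for q x
      proof -
        have q: "sublinear q" "q \<le> p" using that CS by (auto simp: S_def)
        have "q (\<ominus> x) \<le> p (\<ominus> x)" using q(2) by (simp add: le_fun_def)
        then show ?thesis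
          using sublinear_minus[OF q(1), of x] sublinear_off[OF q(1), of x] by auto
      qed
      have bdd: "bdd_below ((\<lambda>q. q x) ` C)" for x
        by (rule bdd_belowI2) (rule low)
      have sub: "sublinear (\<lambda>x. INF q\<in>C. q x)"
        using False CS chain bdd by (intro sublinear_INF_chain) (auto simp: S_def)
      have le: "(\<lambda>x. INF q\<in>C. q x) \<le> q" if "q \<in> C" for q
        by (rule le_funI) (rule cINF_lower[OF bdd that])
      obtain q where "q \<in> C" using False by blast
      then have "(\<lambda>x. INF q\<in>C. q x) \<le> p" using le[of q] CS by (auto simp: S_def)
      then show ?thesis using sub le by (auto simp: S_def)
    qed
  qed
  then show ?thesis using that unfolding S_def by (auto intro: order_trans)
qed

text \<open>With \<open>n\<close> the norm, \<open>f\<close> is chosen minimal below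
  \<open>descent n a\<close>. As \<open>descent n a\<close> lies below \<open>n\<close>, this bounds
  \<open>f\<close>; its value at \<open>\<ominus> a\<close> forces the size of
  \<open>f a\<close>.\<close>

lemma real_functional:
  assumes a: "a \<in> carrier E"
  obtains f where "\<And>x y. x \<in> carrier E \<Longrightarrow> y \<in> carrier E \<Longrightarrow> f (x \<oplus> y) = f x + f y"
    and "\<And>c x. x \<in> carrier E \<Longrightarrow> f (complex_of_real c \<odot> x) = c * f x"
    and "\<And>x. x \<in> carrier E \<Longrightarrow> \<bar>f x\<bar> \<le> nrm E x"
    and "f a \<ge> nrm E a"
proof -
  define n where "n x = (if x \<in> carrier E then nrm E x else 0)" for x
  have n: "sublinear n"
    by (auto simp: sublinear_def n_def nrm_add nrm_scale)
  obtain f where f: "sublinear f" "f \<le> descent n a"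
    and min: "\<And>q. sublinear q \<Longrightarrow> q \<le> f \<Longrightarrow> q = f"
    using minimal_sublinear[OF sublinear_descent[OF n a]] by blast
  have add: "f (x \<oplus> y) = f x + f y" if "x \<in> carrier E" "y \<in> carrier E" for x y
  proof -
    \<comment> \<open>The descent of \<open>f\<close> along any \<open>y\<close> is sublinear and
      below \<open>f\<close>, so by minimality it is \<open>f\<close>. Its parameter 1 then gives
      the missing inequality \<open>f x + f y \<le> f (x \<oplus> y)\<close>.\<close>
    have "descent f y = f"
      using that f by (intro min sublinear_descent descent_le_self)
    then have "f x \<le> f (x \<oplus> y) - f y"
      using descent_le[OF f(1), of y x 1] that by simp
    then show ?thesis using sublinear_add[OF f(1) that] by simp
  qed
  have neg: "f (\<ominus> x) = - f x" if "x \<in> carrier E" for x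
    using add[of x "\<ominus> x"] that sublinear_zero[OF f(1)] by (simp add: r_neg)
  have scale: "f (complex_of_real c \<odot> x) = c * f x" if x: "x \<in> carrier E" for c x
  proof (cases "0 \<le> c")
    case True
    then show ?thesis using sublinear_scale[OF f(1) _ x] by blast
  next
    case False
    have "complex_of_real c \<odot> x \<oplus> complex_of_real (- c) \<odot> x = \<zero>"
      using x scale_add_left[of "complex_of_real c" "complex_of_real (- c)" x]
      by (simp flip: of_real_add del: of_real_minus)
    then have "f (complex_of_real c \<odot> x) + f (complex_of_real (- c) \<odot> x) = 0"
      using x add[of "complex_of_real c \<odot> x" "complex_of_real (- c) \<odot> x"] sublinear_zero[OF f(1)]
      by (simp del: of_real_minus)
    then show ?thesis
      using False sublinear_scale[OF f(1), of "- c" x] x by (simp del: of_real_minus)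
  qed
  have le: "f x \<le> nrm E x" if "x \<in> carrier E" for x
    using f(2) descent_le_self[OF n a] that by (metis le_fun_def n_def order_trans)
  have bound: "\<bar>f x\<bar> \<le> nrm E x" if "x \<in> carrier E" for x
    using le[OF that] le[of "\<ominus> x"] neg[OF that] that by simp
  have "f (\<ominus> a) \<le> descent n a (\<ominus> a)" using f(2) by (simp add: le_fun_def)
  \<comment> \<open>Parameter 1 in the infimum:
    \<open>n (\<ominus> a \<oplus> a) - n a = - n a\<close>.\<close>
  also have "\<dots> \<le> - nrm E a"
    using descent_le[OF n a, of "\<ominus> a" 1] a by (simp add: n_def l_neg)
  finally have "f a \<ge> nrm E a" using neg[OF a] by simp
  then show ?thesis using that add scale bound by blast
qed

text \<open>A \<open>K\<close>-linear functional \<open>\<psi>\<close> is built from the real one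
  and divided by \<open>\<psi> a\<close>, which is nonzero because its real part is at least the
  norm of \<open>a\<close>.\<close>

theorem separating_functional:
  assumes a: "a \<in> carrier E" "a \<noteq> \<zero>"
  obtains \<phi> where "\<And>x. x \<in> carrier E \<Longrightarrow> \<phi> x \<in> K"
    and "\<And>x y. x \<in> carrier E \<Longrightarrow> y \<in> carrier E \<Longrightarrow> \<phi> (x \<oplus> y) = \<phi> x + \<phi> y"
    and "\<And>c x. c \<in> K \<Longrightarrow> x \<in> carrier E \<Longrightarrow> \<phi> (c \<odot> x) = c * \<phi> x"
    and "continuous_map (ntop E) euclidean \<phi>"
    and "\<phi> a = 1"
proof -
  obtain f where f_add: "\<And>x y. x \<in> carrier E \<Longrightarrow> y \<in> carrier E \<Longrightarrow> f (x \<oplus> y) = f x + f y"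
    and f_scale: "\<And>c x. x \<in> carrier E \<Longrightarrow> f (complex_of_real c \<odot> x) = c * f x"
    and f_bound: "\<And>x. x \<in> carrier E \<Longrightarrow> \<bar>f x\<bar> \<le> nrm E x"
    and fa: "f a \<ge> nrm E a"
    using real_functional[OF a(1)] by blast
  have pos: "0 < f a" using fa nrm_eq_0[OF a(1)] nrm_nonneg[OF a(1)] a(2) by linarith
  \<comment> \<open>Both scalar fields are covered by one statement. Only the real part of
    \<open>\<psi> a\<close> is known in the complex case, and the crude constant 2, from adding the
    bounds of real and imaginary part, is enough for continuity.\<close>
  have "\<exists>\<psi>. (\<forall>x\<in>carrier E. \<psi> x \<in> K) \<and>
    (\<forall>x\<in>carrier E. \<forall>y\<in>carrier E. \<psi> (x \<oplus> y) = \<psi> x + \<psi> y) \<and>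
    (\<forall>c\<in>K. \<forall>x\<in>carrier E. \<psi> (c \<odot> x) = c * \<psi> x) \<and>
    (\<forall>x\<in>carrier E. cmod (\<psi> x) \<le> 2 * nrm E x) \<and> Re (\<psi> a) = f a"
    using scalars
  proof
    assume K: "K = \<real>"
    show ?thesis
    proof (intro exI[of _ "\<lambda>x. complex_of_real (f x)"] conjI ballI)
      show "cmod (complex_of_real (f x)) \<le> 2 * nrm E x" if "x \<in> carrier E" for x
        using f_bound[OF that] nrm_nonneg[OF that] by simp
      show "complex_of_real (f (c \<odot> x)) = c * complex_of_real (f x)"
        if "c \<in> K" "x \<in> carrier E" for c x
        using that f_scale by (auto simp: K elim!: Reals_cases)
    qed (simp_all add: f_add)
  next
    assume K: "K = UNIV"
    have cl: "c \<odot> x \<in> carrier E" if "x \<in> carrier E" for c x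
      using that by (simp add: K)
    \<comment> \<open>The complex-linear functional with real part \<open>f\<close>, that is
      \<open>f x - \<i> f (\<i> x)\<close>.\<close>
    define \<psi> where "\<psi> x = Complex (f x) (- f (\<i> \<odot> x))" for x
    have \<psi>_add: "\<psi> (x \<oplus> y) = \<psi> x + \<psi> y" if "x \<in> carrier E" "y \<in> carrier E" for x y
      using that by (simp add: \<psi>_def complex_eq_iff f_add cl scale_add_right K)
    have \<psi>_real: "\<psi> (complex_of_real r \<odot> x) = r * \<psi> x" if x: "x \<in> carrier E" for r x
    proof -
      have "\<i> \<odot> (complex_of_real r \<odot> x) = complex_of_real r \<odot> (\<i> \<odot> x)"
        using x by (simp add: scale_scale K mult.commute)
      then show ?thesis using x by (simp add: \<psi>_def complex_eq_iff f_scale cl)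
    qed
    have \<psi>_i: "\<psi> (\<i> \<odot> x) = \<i> * \<psi> x" if x: "x \<in> carrier E" for x
    proof -
      have "\<i> \<odot> (\<i> \<odot> x) = complex_of_real (- 1) \<odot> x" using x by (simp add: scale_scale K)
      then show ?thesis
        using x f_scale[OF x, of "- 1"] by (simp add: \<psi>_def complex_eq_iff)
    qed
    show ?thesis
    proof (intro exI[of _ \<psi>] conjI ballI)
      fix c x assume x: "x \<in> carrier E"
      have "c \<odot> x = (complex_of_real (Re c) + complex_of_real (Im c) * \<i>) \<odot> x"
        by (metis complex_eq mult.commute)
      also have "\<dots> = complex_of_real (Re c) \<odot> x \<oplus> complex_of_real (Im c) \<odot> (\<i> \<odot> x)"
        using x by (simp add: scale_add_left scale_scale K)
      finally have "\<psi> (c \<odot> x) = Re c * \<psi> x + Im c * (\<i> * \<psi> x)"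
        using x by (simp add: \<psi>_add \<psi>_real \<psi>_i cl)
      also have "\<dots> = (Re c + \<i> * Im c) * \<psi> x" by (simp add: algebra_simps)
      finally show "\<psi> (c \<odot> x) = c * \<psi> x" by (simp flip: complex_eq)
    next
      fix x assume x: "x \<in> carrier E"
      have "cmod (\<psi> x) \<le> \<bar>f x\<bar> + \<bar>f (\<i> \<odot> x)\<bar>"
        using cmod_le[of "\<psi> x"] by (simp add: \<psi>_def)
      also have "\<dots> \<le> nrm E x + nrm E (\<i> \<odot> x)"
        using f_bound[OF x] f_bound[OF cl[OF x]] by (rule add_mono)
      finally show "cmod (\<psi> x) \<le> 2 * nrm E x" using x by (simp add: nrm_scale K)
    qed (simp_all add: K \<psi>_add, simp add: \<psi>_def)
  qed
  then obtain \<psi> where \<psi>: "\<And>x. x \<in> carrier E \<Longrightarrow> \<psi> x \<in> K"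
    "\<And>x y. x \<in> carrier E \<Longrightarrow> y \<in> carrier E \<Longrightarrow> \<psi> (x \<oplus> y) = \<psi> x + \<psi> y"
    "\<And>c x. c \<in> K \<Longrightarrow> x \<in> carrier E \<Longrightarrow> \<psi> (c \<odot> x) = c * \<psi> x"
    "\<And>x. x \<in> carrier E \<Longrightarrow> cmod (\<psi> x) \<le> 2 * nrm E x" and Re: "Re (\<psi> a) = f a"
    by blast
  have nz: "\<psi> a \<noteq> 0" using Re pos by auto
  have lip: "dist (\<psi> x) (\<psi> y) \<le> 2 * ndist E x y" if "x \<in> carrier E" "y \<in> carrier E" for x y
  proof -
    have "\<psi> x = \<psi> (x \<ominus> y) + \<psi> y"
      using \<psi>(2)[of "x \<ominus> y" y] that by (simp add: diff_add_cancel_vector)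
    then show ?thesis using \<psi>(4)[of "x \<ominus> y"] that by (simp add: dist_norm ndist_def)
  qed
  have "continuous_map (ntop E) euclidean \<psi>"
    unfolding metric.continuous_map_from_metric
  proof (intro conjI ballI allI impI)
    fix x U assume x: "x \<in> carrier E" and "openin euclidean U \<and> \<psi> x \<in> U"
    then obtain e where e: "0 < e" "ball (\<psi> x) e \<subseteq> U"
      by (auto simp: open_contains_ball)
    show "\<exists>r>0. \<forall>y. y \<in> carrier E \<and> ndist E x y < r \<longrightarrow> \<psi> y \<in> U"
    proof (intro exI[of _ "e / 2"] conjI allI impI)
      fix y assume "y \<in> carrier E \<and> ndist E x y < e / 2"
      then have "dist (\<psi> x) (\<psi> y) < e" using lip[OF x, of y] by simp
      then show "\<psi> y \<in> U" using e by auto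
    qed (use e in simp)
  qed simp
  moreover have "continuous_map euclidean euclidean (\<lambda>z. z / \<psi> a)"
    using nz by (auto intro!: continuous_intros)
  ultimately have "continuous_map (ntop E) euclidean ((\<lambda>z. z / \<psi> a) \<circ> \<psi>)"
    by (rule continuous_map_compose)
  then have "continuous_map (ntop E) euclidean (\<lambda>x. \<psi> x / \<psi> a)" by (simp add: o_def)
  then show ?thesis
    using \<psi> a nz by (intro that[of "\<lambda>x. \<psi> x / \<psi> a"]) (auto simp: add_divide_distrib)
qed

end

section \<open>Slices of multilinear operators\<close>

lemma banach_space_iterate:
  assumes "seq_class K Y" "banach_space K F"
  shows "banach_space K ((Y ^^ t) F)"
  using assms by (induction t) (auto simp: seq_class_def)

text \<open>Besides typing sequences, this extracts slices: an element of
  \<open>(Y ^^ Suc t) F\<close> is a sequence whose terms lie in \<open>(Y ^^ t) F\<close>.\<close>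

lemma seq_class_termwise:
  assumes "seq_class K X" "banach_space K E" "Seq x \<in> carrier (X E)"
  shows "x j \<in> carrier E"
proof -
  have "Seq x \<in> Seq ` linf E" using assms unfolding seq_class_def by blast
  then show ?thesis by (auto simp: linf_def seqs_in_def)
qed

lemma seq_class_c00:
  assumes "seq_class K X" "banach_space K E" "x \<in> c00 E"
  shows "Seq x \<in> carrier (X E)"
  using assms unfolding seq_class_def by blast

lemma topspace_ntop:
  assumes "K = \<real> \<or> K = UNIV" "banach_space K E"
  shows "topspace (ntop E) = carrier E"
proof -
  interpret banach K E by standard (fact assms)+
  show ?thesis by simp
qed

text \<open>The restriction to the product of the carriers meets the extensionality demanded by
  \<open>multilin_ops\<close>; the shift by \<open>Suc\<close> renumbers the arguments of
  \<open>B\<close> from 0.\<close>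

definition functional_product ::
  "nat \<Rightarrow> (nat \<Rightarrow> 'b nspace) \<Rightarrow> 'c nspace \<Rightarrow> ('b \<Rightarrow> complex) \<Rightarrow> ((nat \<Rightarrow> 'b) \<Rightarrow> 'c) \<Rightarrow>
     (nat \<Rightarrow> 'b) \<Rightarrow> 'c" where
  "functional_product t E F \<phi> B =
     (\<lambda>x\<in>(\<Pi>\<^sub>E i\<in>{..<Suc t}. carrier (E i)). \<phi> (x 0) \<odot>\<^bsub>F\<^esub> B (\<lambda>i\<in>{..<t}. x (Suc i)))"

text \<open>Linearity in slot 0 comes from \<open>\<phi>\<close>, and in slot \<open>Suc j\<close>
  from slot \<open>j\<close> of \<open>B\<close>, with the scalar \<open>\<phi> (x 0)\<close> pulled
  through. Continuity is that of a scalar function times \<open>B\<close> after the shift.\<close>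

lemma functional_product_multilin:
  fixes E :: "nat \<Rightarrow> 'b nspace" and F :: "'c nspace"
  assumes K: "K = \<real> \<or> K = UNIV"
    and E: "\<And>i. i < Suc t \<Longrightarrow> banach_space K (E i)" and F: "banach_space K F"
    and \<phi>: "\<And>x. x \<in> carrier (E 0) \<Longrightarrow> \<phi> x \<in> K"
      "\<And>x y. x \<in> carrier (E 0) \<Longrightarrow> y \<in> carrier (E 0) \<Longrightarrow> \<phi> (x \<oplus>\<^bsub>E 0\<^esub> y) = \<phi> x + \<phi> y"
      "\<And>c x. c \<in> K \<Longrightarrow> x \<in> carrier (E 0) \<Longrightarrow> \<phi> (c \<odot>\<^bsub>E 0\<^esub> x) = c * \<phi> x"
      "continuous_map (ntop (E 0)) euclidean \<phi>"
    and B: "B \<in> multilin_ops K t (\<lambda>i. E (Suc i)) F"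
  shows "functional_product t E F \<phi> B \<in> multilin_ops K (Suc t) E F"
proof -
  interpret F: banach K F by standard (fact K F)+
  let ?D = "\<Pi>\<^sub>E i\<in>{..<Suc t}. carrier (E i)"
  let ?A = "functional_product t E F \<phi> B"
  let ?T = "product_topology (\<lambda>i. ntop (E i)) {..<Suc t}"
  let ?T' = "product_topology (\<lambda>i. ntop (E (Suc i))) {..<t}"
  \<comment> \<open>An update of \<open>x\<close> at 0 is invisible to \<open>sh\<close>, and one at
    \<open>Suc j\<close> becomes an update at \<open>j\<close>.\<close>
  define sh where "sh x = (\<lambda>i\<in>{..<t}. x (Suc i))" for x :: "nat \<Rightarrow> 'b"
  have A: "?A x = \<phi> (x 0) \<odot>\<^bsub>F\<^esub> B (sh x)" if "x \<in> ?D" for x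
    using that by (simp add: functional_product_def sh_def)
  have top: "topspace (ntop (E i)) = carrier (E i)" if "i < Suc t" for i
    using E[OF that] K by (rule topspace_ntop[rotated])
  have topT: "topspace ?T = ?D" and topT': "topspace ?T' = (\<Pi>\<^sub>E i\<in>{..<t}. carrier (E (Suc i)))"
    unfolding topspace_product_topology by (intro PiE_cong; simp add: top)+
  have Blin: "\<And>x i. x \<in> (\<Pi>\<^sub>E i\<in>{..<t}. carrier (E (Suc i))) \<Longrightarrow> i < t \<Longrightarrow>
      linear_map K (E (Suc i)) F (\<lambda>v. B (x(i := v)))"
    and Bcont: "continuous_map ?T' (ntop F) B"
    using B by (auto simp: multilin_ops_def)
  have shD: "sh x \<in> (\<Pi>\<^sub>E i\<in>{..<t}. carrier (E (Suc i)))" if "x \<in> ?D" for x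
    using that by (auto simp: sh_def PiE_iff)
  \<comment> \<open>Taken from continuity, not from linearity in a slot, so that it holds for
    \<open>t = 0\<close> too.\<close>
  have Bcl: "B y \<in> carrier F" if "y \<in> (\<Pi>\<^sub>E i\<in>{..<t}. carrier (E (Suc i)))" for y
    using continuous_map_image_subset_topspace[OF Bcont] that unfolding topT' by auto
  have upd: "x(i := v) \<in> ?D" if "x \<in> ?D" "i < Suc t" "v \<in> carrier (E i)" for x i v
    using that by (auto simp: PiE_iff extensional_def)
  have "linear_map K (E i) F (\<lambda>v. ?A (x(i := v)))" if x: "x \<in> ?D" and i: "i < Suc t" for x i
  proof -
    interpret Ei: banach K "E i" by standard (fact K E[OF i])+
    have x0: "\<phi> (x 0) \<in> K" using x by (auto intro!: \<phi>(1))
    show ?thesis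
    proof (cases i)
      case 0
      have sh0: "sh (x(0 := v)) = sh x" for v by (auto simp: sh_def)
      have A0: "?A (x(i := v)) = \<phi> v \<odot>\<^bsub>F\<^esub> B (sh x)" if "v \<in> carrier (E i)" for v
        using A[OF upd[OF x i that]] by (simp add: 0 sh0)
      note Bx = Bcl[OF shD[OF x]]
      note \<phi>i = \<phi>(1-3)[folded 0]
      show ?thesis
        unfolding linear_map_def
      proof (intro conjI ballI funcsetI)
        fix u v assume "u \<in> carrier (E i)" "v \<in> carrier (E i)"
        then show "?A (x(i := u \<oplus>\<^bsub>E i\<^esub> v)) = ?A (x(i := u)) \<oplus>\<^bsub>F\<^esub> ?A (x(i := v))"
          using Bx by (simp add: A0 \<phi>i F.scale_add_left)
      next
        fix c v assume "c \<in> K" "v \<in> carrier (E i)"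
        then show "?A (x(i := c \<odot>\<^bsub>E i\<^esub> v)) = c \<odot>\<^bsub>F\<^esub> ?A (x(i := v))"
          using Bx by (simp add: A0 \<phi>i F.scale_scale)
      qed (use Bx in \<open>simp add: A0 \<phi>i\<close>)
    next
      case (Suc j)
      then have j: "j < t" using i by simp
      have shS: "sh (x(Suc j := v)) = (sh x)(j := v)" for v using j by (auto simp: sh_def)
      note lin = Blin[OF shD[OF x] j, unfolded linear_map_def]
      have AS: "?A (x(i := v)) = \<phi> (x 0) \<odot>\<^bsub>F\<^esub> B ((sh x)(j := v))" if "v \<in> carrier (E i)" for v
        using A[OF upd[OF x i that]] by (simp add: Suc shS)
      have cl: "B ((sh x)(j := v)) \<in> carrier F" if "v \<in> carrier (E i)" for v
        using lin that by (auto simp: Suc)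
      show ?thesis
        unfolding linear_map_def
      proof (intro conjI ballI funcsetI)
        fix u v assume uv: "u \<in> carrier (E i)" "v \<in> carrier (E i)"
        have "B ((sh x)(j := u \<oplus>\<^bsub>E i\<^esub> v)) = B ((sh x)(j := u)) \<oplus>\<^bsub>F\<^esub> B ((sh x)(j := v))"
          using lin uv by (auto simp: Suc)
        then show "?A (x(i := u \<oplus>\<^bsub>E i\<^esub> v)) = ?A (x(i := u)) \<oplus>\<^bsub>F\<^esub> ?A (x(i := v))"
          using uv x0 by (simp add: AS cl F.scale_add_right)
      next
        fix c v assume cv: "c \<in> K" "v \<in> carrier (E i)"
        have "B ((sh x)(j := c \<odot>\<^bsub>E i\<^esub> v)) = c \<odot>\<^bsub>F\<^esub> B ((sh x)(j := v))"
          using lin cv by (auto simp: Suc)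
        then show "?A (x(i := c \<odot>\<^bsub>E i\<^esub> v)) = c \<odot>\<^bsub>F\<^esub> ?A (x(i := v))"
          using cv x0 by (simp add: AS cl F.scale_scale mult.commute)
      qed (use x0 in \<open>simp add: AS cl\<close>)
    qed
  qed
  moreover have "continuous_map ?T (ntop F) ?A"
  proof -
    have proj: "continuous_map ?T (ntop (E i)) (\<lambda>x. x i)" if "i < Suc t" for i
      using that by (intro continuous_map_product_projection) simp
    have "continuous_map ?T ?T' sh"
      unfolding continuous_map_componentwise
    proof (intro conjI ballI)
      show "continuous_map ?T (ntop (E (Suc k))) (\<lambda>x. sh x k)" if "k \<in> {..<t}" for k
        using that proj[of "Suc k"] by (simp add: sh_def)
    qed (auto simp: sh_def)
    then have "continuous_map ?T (ntop F) (B \<circ> sh)"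
      using Bcont by (rule continuous_map_compose)
    moreover have "continuous_map ?T euclidean (\<phi> \<circ> (\<lambda>x. x 0))"
      by (rule continuous_map_compose[OF proj \<phi>(4)]) simp
    ultimately have "continuous_map ?T (ntop F) (\<lambda>x. (\<phi> \<circ> (\<lambda>x. x 0)) x \<odot>\<^bsub>F\<^esub> (B \<circ> sh) x)"
    proof (rule F.continuous_map_scale[rotated 2])
      show "(\<phi> \<circ> (\<lambda>x. x 0)) x \<in> K" if "x \<in> topspace ?T" for x
        using that unfolding topT by (auto intro!: \<phi>(1))
    qed
    then show ?thesis
      by (rule continuous_map_eq) (simp add: topT A del: topspace_product_topology)
  qed
  ultimately show ?thesis
    by (auto simp: multilin_ops_def functional_product_def)
qed

section \<open>Passing from \<open>d\<close> to \<open>d - 1\<close> variables\<close>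

theorem corollary4p7:
  fixes K :: "complex set" and d :: nat
    and X :: "nat \<Rightarrow> 'a seq_rule" and Y :: "'a seq_rule"
    and E :: "nat \<Rightarrow> 'a univ nspace" and F :: "'a univ nspace"
  assumes "K = \<real> \<or> K = UNIV"
    and "d \<ge> 2"
    and "\<And>i. i < d \<Longrightarrow> seq_class K (X i)"
    and "seq_class K Y" and "linearly_stable K Y"
    and "\<And>i. i < d \<Longrightarrow> banach_space K (E i)"
    and "banach_space K F"
    and "carrier (E 0) \<noteq> {\<zero>\<^bsub>E 0\<^esub>}"
    and "multilin_ops K d E F = summing_ops K d X Y E F"
  shows "multilin_ops K (d - 1) (\<lambda>i. E (Suc i)) F =
         summing_ops K (d - 1) (\<lambda>i. X (Suc i)) Y (\<lambda>i. E (Suc i)) F"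
proof -
  define t where "t = d - 1"
  have d: "d = Suc t" using assms(2) by (simp add: t_def)
  have E: "banach_space K (E i)" if "i < Suc t" for i using assms(6) that by (simp add: d)
  have X: "seq_class K (X i)" if "i < Suc t" for i using assms(3) that by (simp add: d)
  interpret E0: banach K "E 0" by standard (fact assms(1) E[OF zero_less_Suc])+
  interpret F: banach K F by standard (fact assms(1,7))+
  \<comment> \<open>Over a zero space \<open>E 0\<close> every \<open>d\<close>-linear operator
    vanishes and the hypothesis would carry no information about \<open>B\<close>.\<close>
  obtain a where a: "a \<in> carrier (E 0)" "a \<noteq> \<zero>\<^bsub>E 0\<^esub>"
    using assms(8) E0.zero_closed by blast
  obtain \<phi> where \<phi>: "\<And>x. x \<in> carrier (E 0) \<Longrightarrow> \<phi> x \<in> K"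
    "\<And>x y. x \<in> carrier (E 0) \<Longrightarrow> y \<in> carrier (E 0) \<Longrightarrow> \<phi> (x \<oplus>\<^bsub>E 0\<^esub> y) = \<phi> x + \<phi> y"
    "\<And>c x. c \<in> K \<Longrightarrow> x \<in> carrier (E 0) \<Longrightarrow> \<phi> (c \<odot>\<^bsub>E 0\<^esub> x) = c * \<phi> x"
    "continuous_map (ntop (E 0)) euclidean \<phi>" and \<phi>a: "\<phi> a = 1"
    using E0.separating_functional[OF a] by blast
  have "B \<in> summing_ops K t (\<lambda>i. X (Suc i)) Y (\<lambda>i. E (Suc i)) F"
    if B: "B \<in> multilin_ops K t (\<lambda>i. E (Suc i)) F" for B
    unfolding summing_ops_def
  proof (intro CollectI conjI allI impI B)
    fix x assume x: "\<forall>r<t. Seq (x r) \<in> carrier (X (Suc r) (E (Suc r)))"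
    let ?A = "functional_product t E F \<phi> B"
    \<comment> \<open>The given sequences move up by one slot, and slot 0 receives
      \<open>(a, 0, 0, \<dots>)\<close>, which is eventually null and hence in every sequence
      class.\<close>
    define y where "y r = (case r of 0 \<Rightarrow> (\<lambda>n. if n = 0 then a else \<zero>\<^bsub>E 0\<^esub>) | Suc s \<Rightarrow> x s)" for r
    have "y 0 \<in> c00 (E 0)"
      using a by (auto simp: y_def c00_def seqs_in_def intro!: eventually_sequentiallyI[of 1])
    then have y: "Seq (y r) \<in> carrier (X r (E r))" if "r < Suc t" for r
      using that x seq_class_c00[OF X E, of 0] by (cases r) (auto simp: y_def)
    then have ycl: "y r n \<in> carrier (E r)" if "r < Suc t" for r n
      using that seq_class_termwise[OF X E] by blast
    have "?A \<in> summing_ops K (Suc t) X Y E F"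
      using functional_product_multilin[OF assms(1) E assms(7) \<phi> B] assms(9) by (simp add: d)
    then have "iter_seq (Suc t) (\<lambda>ns. ?A (\<lambda>r\<in>{..<Suc t}. y r (ns ! r))) \<in> carrier ((Y ^^ Suc t) F)"
      using y by (simp add: summing_ops_def del: iter_seq.simps funpow.simps)
    \<comment> \<open>The term with outermost index 0 is the one in which the first variable equals
      \<open>a\<close>.\<close>
    then have "iter_seq t (\<lambda>ns. ?A (\<lambda>r\<in>{..<Suc t}. y r ((0 # ns) ! r))) \<in> carrier ((Y ^^ t) F)"
      using seq_class_termwise[OF assms(4) banach_space_iterate[OF assms(4,7)], where j = 0] by simp
    moreover have "?A (\<lambda>r\<in>{..<Suc t}. y r ((0 # ns) ! r)) = B (\<lambda>r\<in>{..<t}. x r (ns ! r))" for ns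
    proof -
      have sh: "(\<lambda>i\<in>{..<t}. (\<lambda>r\<in>{..<Suc t}. y r ((0 # ns) ! r)) (Suc i)) = (\<lambda>r\<in>{..<t}. x r (ns ! r))"
        by (auto simp: y_def)
      \<comment> \<open>Needed to cancel the factor \<open>\<phi> a = 1\<close>. Replacing slot 0 by
        its own value, possible as \<open>d \<ge> 2\<close> makes \<open>t\<close> positive, reads
        the membership off the linearity in that slot.\<close>
      have "B (\<lambda>r\<in>{..<t}. x r (ns ! r)) \<in> carrier F"
      proof -
        have "0 < t" using assms(2) d by simp
        have xD: "(\<lambda>r\<in>{..<t}. x r (ns ! r)) \<in> (\<Pi>\<^sub>E i\<in>{..<t}. carrier (E (Suc i)))"
          using ycl[of "Suc _"] by (auto simp: y_def)
        then have "linear_map K (E (Suc 0)) F (\<lambda>v. B ((\<lambda>r\<in>{..<t}. x r (ns ! r))(0 := v)))"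
          using B \<open>0 < t\<close> by (auto simp: multilin_ops_def)
        then have "B ((\<lambda>r\<in>{..<t}. x r (ns ! r))(0 := x 0 (ns ! 0))) \<in> carrier F"
          using ycl[of "Suc 0" "ns ! 0"] \<open>0 < t\<close> by (auto simp: linear_map_def y_def)
        moreover have "(\<lambda>r\<in>{..<t}. x r (ns ! r))(0 := x 0 (ns ! 0)) = (\<lambda>r\<in>{..<t}. x r (ns ! r))"
          using \<open>0 < t\<close> by auto
        ultimately show ?thesis by simp
      qed
      moreover have "(\<lambda>r\<in>{..<Suc t}. y r ((0 # ns) ! r)) \<in> (\<Pi>\<^sub>E i\<in>{..<Suc t}. carrier (E i))"
        using ycl by auto
      ultimately show ?thesis
        unfolding functional_product_def by (simp only: restrict_apply' sh) (simp add: y_def \<phi>a)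
    qed
    ultimately show "iter_seq t (\<lambda>ns. B (\<lambda>r\<in>{..<t}. x r (ns ! r))) \<in> carrier ((Y ^^ t) F)"
      by simp
  qed
  \<comment> \<open>The other inclusion is built into \<open>summing_ops\<close>.\<close>
  then show ?thesis
    unfolding t_def[symmetric] by (auto simp: summing_ops_def)
qed

end
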